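(* Let $n_1,T\ge1$, $p_1\in\{1,\dots,n_1\}$, and let $\tilde e_t^{(i)}\ge0$ ($t=0,\dots,T-1$, $i=1,\dots,n_1$) be given nonnegative reals. Consider the programs (MILP) and (MILP-fast) and the index sets $S_1,S_2,S$ defined in the context, where $S_2$ is formed from an arbitrary feasible solution of (MILP). (i) If $|S_1|<p_1$, then (MILP-fast) is feasible, and the set of vectors $(r_0^*,\dots,r_{T-1}^* )$ that occur as the $r$-part of an optimal solution of (MILP-fast) coincides with the set of vectors that occur as the $r$-part of an optimal solution of (MILP). (ii) If $|S_1|\ge p_1$, then the optimal solution of (MILP) is $r_t^*=\tilde e_t^{[p_1]}$, $t=0,\dots,T-1$.
   Context: (MILP): minimize $\sum_{t=0}^{T-1}r_t$ over $r\in\mathbb{R}^T$ and $b_1,\dots,b_{n_1}\in\{0,1\}$ subject to $r_t\ge\tilde e_t^{(i)}b_i$ for all $t=0,\dots,T-1$ and $i=1,\dots,n_1$, and $\sum_{i=1}^{n_1}b_i=p_1$. In the application, $\tilde e_t^{(i)}=\|\tilde Y_t^{(i)}\|$ are norms of residual vectors and $p_1=\lceil(1-\epsilon)(n_1+1)\rceil$ for an error level $\epsilon\in(0,1)$ with $\epsilon\ge 1/(n_1+1)$. For each $t$, $\tilde e_t^{[p_1]}$ denotes the $p_1$-th smallest value (counted with multiplicity) among $\tilde e_t^{(1)},\dots,\tilde e_t^{(n_1)}$. Let $(r_0^{(\mathrm{feas})},\dots,r_{T-1}^{(\mathrm{feas})},b_1^{(\mathrm{feas})},\dots,b_{n_1}^{(\mathrm{feas})})$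 be a feasible solution of (MILP). Define $$S_1=\{i\in\{1,\dots,n_1\}:\tilde e_t^{(i)}\le\tilde e_t^{[p_1]}\ \text{for all } t=0,\dots,T-1\},$$ $$S_2=\{i\in\{1,\dots,n_1\}:\tilde e_t^{(i)}>r_t^{(\mathrm{feas})}\ \text{for all } t=0,\dots,T-1\},$$ $$S=\{1,\dots,n_1\}\setminus(S_1\cup S_2).$$ (MILP-fast): minimize $\sum_{t=0}^{T-1}r_t$ over $r\in\mathbb{R}^T$ and $b_i\in\{0,1\}$ ($i\in S$) subject to $r_t\ge\tilde e_t^{(i)}b_i$ for all $t=0,\dots,T-1$ and $i\in S$; $r_t\ge\max_{i\in S_1}\tilde e_t^{(i)}$ for all $t=0,\dots,T-1$ (this constraint is vacuous if $S_1=\emptyset$); and $\sum_{i\in S}b_i=p_1-|S_1|$. In (ii), "the optimal solution" refers to the radii $r_t$ (the binary variables are not specified). *)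

theory Defs
  imports Complex_Main "HOL-Library.FuncSet"
begin

text \<open>The data are \<open>e t i\<close> for times \<open>t < T\<close> and samples \<open>i \<in> {1..n}\<close>. Vectors indexed by a finite
  set are extensional functions on it, so that two vectors agreeing on the index set are equal; the
  binary variables take the real values 0 and 1.\<close>

definition milp_feasible ::
  "nat \<Rightarrow> nat \<Rightarrow> nat \<Rightarrow> (nat \<Rightarrow> nat \<Rightarrow> real) \<Rightarrow> (nat \<Rightarrow> real) \<times> (nat \<Rightarrow> real) \<Rightarrow> bool" where
  "milp_feasible n T p e = (\<lambda>(r, b).
     r \<in> {..<T} \<rightarrow>\<^sub>E UNIV \<and> b \<in> {1..n} \<rightarrow>\<^sub>E {0, 1} \<and>
     (\<forall>t<T. \<forall>i\<in>{1..n}. r t \<ge> e t i * b i) \<and>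
     (\<Sum>i\<in>{1..n}. b i) = real p)"

definition objective :: "nat \<Rightarrow> (nat \<Rightarrow> real) \<times> (nat \<Rightarrow> real) \<Rightarrow> real" where
  "objective T = (\<lambda>(r, b). \<Sum>t<T. r t)"

text \<open>The \<open>p\<close>-th smallest of \<open>e t 1, \<dots>, e t n\<close>, with multiplicity; meaningful for \<open>1 \<le> p \<le> n\<close>
  (list positions count from 0).\<close>

definition pth_smallest :: "nat \<Rightarrow> nat \<Rightarrow> (nat \<Rightarrow> nat \<Rightarrow> real) \<Rightarrow> nat \<Rightarrow> real" where
  "pth_smallest n p e t = sort (map (e t) [1..<Suc n]) ! (p - 1)"

definition S1 :: "nat \<Rightarrow> nat \<Rightarrow> nat \<Rightarrow> (nat \<Rightarrow> nat \<Rightarrow> real) \<Rightarrow> nat set" where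
  "S1 n T p e = {i \<in> {1..n}. \<forall>t<T. e t i \<le> pth_smallest n p e t}"

definition S2 :: "nat \<Rightarrow> nat \<Rightarrow> (nat \<Rightarrow> nat \<Rightarrow> real) \<Rightarrow> (nat \<Rightarrow> real) \<Rightarrow> nat set" where
  "S2 n T e rfeas = {i \<in> {1..n}. \<forall>t<T. e t i > rfeas t}"

definition S_rest :: "nat \<Rightarrow> nat \<Rightarrow> nat \<Rightarrow> (nat \<Rightarrow> nat \<Rightarrow> real) \<Rightarrow> (nat \<Rightarrow> real) \<Rightarrow> nat set" where
  "S_rest n T p e rfeas = {1..n} - (S1 n T p e \<union> S2 n T e rfeas)"

text \<open>The cardinality constraint is stated over the reals, so its right-hand side is not truncated.\<close>

definition milp_fast_feasible ::
  "nat \<Rightarrow> nat \<Rightarrow> nat \<Rightarrow> (nat \<Rightarrow> nat \<Rightarrow> real) \<Rightarrow> (nat \<Rightarrow> real)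
     \<Rightarrow> (nat \<Rightarrow> real) \<times> (nat \<Rightarrow> real) \<Rightarrow> bool" where
  "milp_fast_feasible n T p e rfeas = (\<lambda>(r, b).
     r \<in> {..<T} \<rightarrow>\<^sub>E UNIV \<and> b \<in> S_rest n T p e rfeas \<rightarrow>\<^sub>E {0, 1} \<and>
     (\<forall>t<T. \<forall>i\<in>S_rest n T p e rfeas. r t \<ge> e t i * b i) \<and>
     (S1 n T p e \<noteq> {} \<longrightarrow> (\<forall>t<T. r t \<ge> Max (e t ` S1 n T p e))) \<and>
     (\<Sum>i\<in>S_rest n T p e rfeas. b i) = real p - real (card (S1 n T p e)))"

definition optimal_radii ::
  "nat \<Rightarrow> ((nat \<Rightarrow> real) \<times> (nat \<Rightarrow> real) \<Rightarrow> bool) \<Rightarrow> (nat \<Rightarrow> real) set" where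
  "optimal_radii T feasible = {r. \<exists>b. is_arg_min (objective T) feasible (r, b)}"

end

theory Submission
  imports Defs
begin

text \<open>A radius vector \<open>r\<close> extends to a feasible solution iff at least the required number of samples
  is \<^emph>\<open>covered\<close>, meaning \<open>e t i \<le> r t\<close> for all \<open>t\<close>. Hence feasible radii dominate the \<open>p\<close>-th smallest
  values, so they always cover \<open>S1\<close>; when \<open>S1\<close> has at least \<open>p\<close> elements this lower bound is attained.
  Otherwise, radii covering no sample in \<open>S2\<close> are feasible for both programs or for neither, while
  radii covering a sample in \<open>S2\<close> exceed \<open>rfeas\<close> in every coordinate and so are never optimal;
  \<open>rfeas\<close> itself covers no sample in \<open>S2\<close>.\<close>

definition covered :: "'i set \<Rightarrow> nat \<Rightarrow> (nat \<Rightarrow> 'i \<Rightarrow> real) \<Rightarrow> (nat \<Rightarrow> real) \<Rightarrow> 'i set" where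
  "covered I T e r = {i \<in> I. \<forall>t<T. e t i \<le> r t}"

lemma finite_covered [simp]: "finite I \<Longrightarrow> finite (covered I T e r)"
  by (simp add: covered_def)

text \<open>If the entry at position \<open>p - 1\<close> of the sorted list exceeded
  \<open>x\<close>, sortedness would leave entries \<le> \<open>x\<close> only at positions below
  \<open>p - 1\<close>, hence at most \<open>p - 1\<close> of them.\<close>

lemma pth_smallest_le:
  assumes "1 \<le> p" and le: "p \<le> card {i \<in> {1..n}. e t i \<le> x}"
  shows "pth_smallest n p e t \<le> x"
proof (rule ccontr)
  let ?xs = "sort (map (e t) [1..<Suc n])"
  assume "\<not> pth_smallest n p e t \<le> x"
  then have gt: "x < ?xs ! (p - 1)"
    by (simp add: pth_smallest_def)
  have "k < p - 1" if k: "k < length ?xs" "?xs ! k \<le> x" for k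
  proof (rule ccontr)
    assume "\<not> k < p - 1"
    then have "?xs ! (p - 1) \<le> ?xs ! k"
      using k(1) by (intro sorted_nth_mono) auto
    with gt k(2) show False
      by linarith
  qed
  then have "{k. k < length ?xs \<and> ?xs ! k \<le> x} \<subseteq> {..<p - 1}"
    by blast
  then have "length (filter (\<lambda>y. y \<le> x) ?xs) \<le> p - 1"
    using card_mono[of "{..<p - 1}"] by (fastforce simp: length_filter_conv_card)
  \<comment> \<open>Filtering is pulled back from values to indices, which are distinct; equal
    values of different samples are thus counted separately.\<close>
  moreover have "length (filter (\<lambda>y. y \<le> x) ?xs) = card {i \<in> {1..n}. e t i \<le> x}"
  proof -
    have "length (filter (\<lambda>y. y \<le> x) ?xs) = length (filter (\<lambda>i. e t i \<le> x) [1..<Suc n])"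
      by (simp only: filter_sort length_sort filter_map length_map comp_def)
    also have "\<dots> = card (set (filter (\<lambda>i. e t i \<le> x) [1..<Suc n]))"
      by (rule distinct_card[symmetric]) simp
    also have "set (filter (\<lambda>i. e t i \<le> x) [1..<Suc n]) = {i \<in> {1..n}. e t i \<le> x}"
      by auto
    finally show ?thesis .
  qed
  ultimately show False
    using assms by linarith
qed

text \<open>A selected sample must be covered, since \<open>b i = 1\<close> turns its constraints
  into coverage; conversely any \<open>q\<close> covered samples may be selected. The index set is
  kept general because the full program uses \<open>{1..n}\<close> and the reduced one
  \<open>S_rest n T p e rfeas\<close>.\<close>

lemma ex_selection_iff:
  fixes e :: "nat \<Rightarrow> 'i \<Rightarrow> real"
  assumes "finite I" and "1 \<le> q" and nonneg: "\<And>t i. t < T \<Longrightarrow> i \<in> I \<Longrightarrow> e t i \<ge> 0"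
  shows "(\<exists>b. b \<in> I \<rightarrow>\<^sub>E {0, 1} \<and> (\<forall>t<T. \<forall>i\<in>I. r t \<ge> e t i * b i) \<and> (\<Sum>i\<in>I. b i) = real q)
    \<longleftrightarrow> q \<le> card (covered I T e r)"
proof
  assume "\<exists>b. b \<in> I \<rightarrow>\<^sub>E {0, 1} \<and> (\<forall>t<T. \<forall>i\<in>I. r t \<ge> e t i * b i) \<and> (\<Sum>i\<in>I. b i) = real q"
  then obtain b where b: "b \<in> I \<rightarrow>\<^sub>E {0, 1}" "\<And>t i. t < T \<Longrightarrow> i \<in> I \<Longrightarrow> r t \<ge> e t i * b i"
    and sum_b: "(\<Sum>i\<in>I. b i) = real q"
    by blast
  have b01: "b i = 0 \<or> b i = 1" if "i \<in> I" for i
    using b(1) that by (auto simp: PiE_iff)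
  have sub: "{i \<in> I. b i = 1} \<subseteq> covered I T e r"
    using b(2) by (fastforce simp: covered_def)
  have "(\<Sum>i\<in>I. b i) = (\<Sum>i\<in>I. if b i = 1 then 1 else 0)"
    using b01 by (intro sum.cong) auto
  then have "real q = card {i \<in> I. b i = 1}"
    using sum_b assms(1) by (simp add: sum.If_cases Int_def)
  then show "q \<le> card (covered I T e r)"
    using sub assms(1) by (simp add: card_mono)
next
  assume q: "q \<le> card (covered I T e r)"
  then obtain B where B: "B \<subseteq> covered I T e r" "card B = q"
    by (meson obtain_subset_with_card_n)
  \<comment> \<open>An unselected sample still demands \<open>r t \<ge> 0\<close>. This follows from
    one covered sample, whose values are nonnegative; \<open>1 \<le> q\<close> provides it.\<close>
  obtain j where j: "j \<in> covered I T e r"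
    using q assms(2) by fastforce
  have r0: "0 \<le> r t" if "t < T" for t
    using j nonneg[OF that, of j] that by (force simp: covered_def)
  have "B \<subseteq> I"
    using B(1) by (auto simp: covered_def)
  then have "(\<Sum>i\<in>I. (\<lambda>i\<in>I. if i \<in> B then 1 else 0) i) = real q"
    using assms(1) B(2) by (simp add: sum.If_cases inf_absorb2)
  moreover have "r t \<ge> e t i * (\<lambda>i\<in>I. if i \<in> B then 1 else 0) i" if "t < T" "i \<in> I" for t i
    using that B(1) r0 by (auto simp: covered_def)
  ultimately show "\<exists>b. b \<in> I \<rightarrow>\<^sub>E {0, 1} \<and> (\<forall>t<T. \<forall>i\<in>I. r t \<ge> e t i * b i) \<and>
      (\<Sum>i\<in>I. b i) = real q"
    by (intro exI[of _ "\<lambda>i\<in>I. if i \<in> B then 1 else 0"]) auto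
qed

text \<open>The objective ignores \<open>b\<close>, so optimality can be judged on the radii that
  extend to a feasible pair.\<close>

lemma mem_optimal_radii_iff:
  "r \<in> optimal_radii T F \<longleftrightarrow>
     (\<exists>b. F (r, b)) \<and> (\<forall>r'. (\<exists>b. F (r', b)) \<longrightarrow> (\<Sum>t<T. r t) \<le> (\<Sum>t<T. r' t))"
  unfolding optimal_radii_def is_arg_min_def objective_def
  by (auto simp: not_less)

lemma ex_milp_feasible_iff:
  assumes "1 \<le> p" and "\<And>t i. t < T \<Longrightarrow> i \<in> {1..n} \<Longrightarrow> e t i \<ge> 0"
  shows "(\<exists>b. milp_feasible n T p e (r, b)) \<longleftrightarrow>
    r \<in> {..<T} \<rightarrow>\<^sub>E UNIV \<and> p \<le> card (covered {1..n} T e r)"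
  using ex_selection_iff[of "{1..n}" p T e r] assms
  by (simp add: milp_feasible_def)

text \<open>The strict bound on \<open>card (S1 n T p e)\<close> makes the residual quota a positive
  natural number, as \<open>ex_selection_iff\<close> requires. The constraint with
  \<open>Max\<close> says exactly that \<open>r\<close> covers \<open>S1 n T p e\<close>.\<close>

lemma ex_milp_fast_feasible_iff:
  assumes "card (S1 n T p e) < p" and "\<And>t i. t < T \<Longrightarrow> i \<in> {1..n} \<Longrightarrow> e t i \<ge> 0"
  shows "(\<exists>b. milp_fast_feasible n T p e rfeas (r, b)) \<longleftrightarrow>
    r \<in> {..<T} \<rightarrow>\<^sub>E UNIV \<and> S1 n T p e \<subseteq> covered {1..n} T e r \<and>
    p \<le> card (S1 n T p e) + card (covered (S_rest n T p e rfeas) T e r)"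
proof -
  let ?S = "S_rest n T p e rfeas" and ?q = "p - card (S1 n T p e)"
  have fin: "finite (S1 n T p e)" "finite ?S"
    by (simp_all add: S1_def S_rest_def)
  have q: "real p - real (card (S1 n T p e)) = real ?q"
    using assms(1) by simp
  have max: "(S1 n T p e \<noteq> {} \<longrightarrow> (\<forall>t<T. r t \<ge> Max (e t ` S1 n T p e))) \<longleftrightarrow>
      S1 n T p e \<subseteq> covered {1..n} T e r"
    using fin(1) by (auto simp: covered_def S1_def)
  have "(\<exists>b. milp_fast_feasible n T p e rfeas (r, b)) \<longleftrightarrow>
      r \<in> {..<T} \<rightarrow>\<^sub>E UNIV \<and> S1 n T p e \<subseteq> covered {1..n} T e r \<and>
      (\<exists>b. b \<in> ?S \<rightarrow>\<^sub>E {0, 1} \<and> (\<forall>t<T. \<forall>i\<in>?S. r t \<ge> e t i * b i) \<and> (\<Sum>i\<in>?S. b i) = real ?q)"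
    unfolding milp_fast_feasible_def prod.case max q by blast
  also have "(\<exists>b. b \<in> ?S \<rightarrow>\<^sub>E {0, 1} \<and> (\<forall>t<T. \<forall>i\<in>?S. r t \<ge> e t i * b i) \<and>
      (\<Sum>i\<in>?S. b i) = real ?q) \<longleftrightarrow> ?q \<le> card (covered ?S T e r)"
    using assms fin(2) by (intro ex_selection_iff) (auto simp: S_rest_def)
  also have "?q \<le> card (covered ?S T e r) \<longleftrightarrow> p \<le> card (S1 n T p e) + card (covered ?S T e r)"
    by linarith
  finally show ?thesis .
qed

lemma pth_smallest_le_radius:
  assumes "1 \<le> p" and "p \<le> card (covered {1..n} T e r)" and "t < T"
  shows "pth_smallest n p e t \<le> r t"
proof (rule pth_smallest_le[OF assms(1)])
  have "covered {1..n} T e r \<subseteq> {i \<in> {1..n}. e t i \<le> r t}"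
    using assms(3) by (auto simp: covered_def)
  then show "p \<le> card {i \<in> {1..n}. e t i \<le> r t}"
    by (intro order_trans[OF assms(2)] card_mono) auto
qed

lemma S1_subset_covered:
  assumes "1 \<le> p" and "p \<le> card (covered {1..n} T e r)"
  shows "S1 n T p e \<subseteq> covered {1..n} T e r"
  using pth_smallest_le_radius[OF assms] by (force simp: S1_def covered_def)

text \<open>A covered sample \<open>i\<close> in \<open>S2\<close> gives
  \<open>rfeas t < e t i \<le> r t\<close> for every \<open>t < T\<close>; \<open>1 \<le> T\<close>
  rules out comparing empty sums.\<close>

lemma covered_S2_sum_less:
  assumes "1 \<le> T" and "covered {1..n} T e r \<inter> S2 n T e rfeas \<noteq> {}"
  shows "(\<Sum>t<T. rfeas t) < (\<Sum>t<T. r t)"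
  using assms by (intro sum_strict_mono) (force simp: covered_def S2_def lessThan_empty_iff)+

lemma fast_feasible_imp_feasible:
  assumes "card (S1 n T p e) < p" and "\<And>t i. t < T \<Longrightarrow> i \<in> {1..n} \<Longrightarrow> e t i \<ge> 0"
    and "\<exists>b. milp_fast_feasible n T p e rfeas (r, b)"
  shows "\<exists>b. milp_feasible n T p e (r, b)"
proof -
  let ?S = "S_rest n T p e rfeas"
  have p: "1 \<le> p"
    using assms(1) by simp
  have r: "r \<in> {..<T} \<rightarrow>\<^sub>E UNIV" "S1 n T p e \<subseteq> covered {1..n} T e r"
    "p \<le> card (S1 n T p e) + card (covered ?S T e r)"
    using assms(3) ex_milp_fast_feasible_iff[OF assms(1,2)] by simp_all
  \<comment> \<open>\<open>S_rest\<close> excludes \<open>S1\<close>, so no sample is counted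
    twice.\<close>
  have "card (S1 n T p e) + card (covered ?S T e r) = card (S1 n T p e \<union> covered ?S T e r)"
    by (rule card_Un_disjoint[symmetric]) (auto simp: S1_def S_rest_def covered_def)
  also have "\<dots> \<le> card (covered {1..n} T e r)"
    using r(2) by (intro card_mono) (auto simp: S_rest_def covered_def)
  finally show ?thesis
    using r ex_milp_feasible_iff[OF p assms(2)] by simp
qed

lemma feasible_imp_fast_feasible:
  assumes "card (S1 n T p e) < p" and "\<And>t i. t < T \<Longrightarrow> i \<in> {1..n} \<Longrightarrow> e t i \<ge> 0"
    and "\<exists>b. milp_feasible n T p e (r, b)"
    and "covered {1..n} T e r \<inter> S2 n T e rfeas = {}"
  shows "\<exists>b. milp_fast_feasible n T p e rfeas (r, b)"
proof -
  let ?S = "S_rest n T p e rfeas"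
  have p: "1 \<le> p"
    using assms(1) by simp
  have r: "r \<in> {..<T} \<rightarrow>\<^sub>E UNIV" "p \<le> card (covered {1..n} T e r)"
    using assms(3) ex_milp_feasible_iff[OF p assms(2)] by simp_all
  \<comment> \<open>With no covered sample in \<open>S2\<close>, each covered sample outside
    \<open>S1\<close> lies in \<open>S_rest\<close>.\<close>
  have "covered {1..n} T e r \<subseteq> S1 n T p e \<union> covered ?S T e r"
    using assms(4) by (auto simp: S_rest_def covered_def)
  then have "card (covered {1..n} T e r) \<le> card (S1 n T p e \<union> covered ?S T e r)"
    by (intro card_mono) (auto simp: S1_def S_rest_def)
  also have "\<dots> \<le> card (S1 n T p e) + card (covered ?S T e r)"
    by (rule card_Un_le)
  finally show ?thesis
    using r S1_subset_covered[OF p] ex_milp_fast_feasible_iff[OF assms(1,2)] by simp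
qed

lemma optimal_radii_milp_fast_eq:
  assumes "1 \<le> T" and few: "card (S1 n T p e) < p"
    and nonneg: "\<And>t i. t < T \<Longrightarrow> i \<in> {1..n} \<Longrightarrow> e t i \<ge> 0"
    and feas: "\<exists>b. milp_feasible n T p e (rfeas, b)"
  shows "\<exists>x. milp_fast_feasible n T p e rfeas x"
    and "optimal_radii T (milp_fast_feasible n T p e rfeas) = optimal_radii T (milp_feasible n T p e)"
proof -
  let ?F = "\<lambda>r. \<exists>b. milp_feasible n T p e (r, b)"
  let ?G = "\<lambda>r. \<exists>b. milp_fast_feasible n T p e rfeas (r, b)"
  have GF: "?F r" if "?G r" for r
    using fast_feasible_imp_feasible[OF few nonneg that] .
  have FG: "?G r \<or> (\<Sum>t<T. rfeas t) < (\<Sum>t<T. r t)" if "?F r" for r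
    using feasible_imp_fast_feasible[OF few nonneg that] covered_S2_sum_less[OF assms(1)] by blast
  \<comment> \<open>For \<open>r = rfeas\<close> the second alternative of \<open>FG\<close> would
    be a strict inequality of a sum with itself.\<close>
  have Gfeas: "?G rfeas"
    using FG[OF feas] by simp
  then show "\<exists>x. milp_fast_feasible n T p e rfeas x"
    by blast
  \<comment> \<open>Both programs have the same lower bounds: radii feasible only for the full
    program cost more than \<open>rfeas\<close>, which is feasible for both.\<close>
  have "(\<forall>r'. ?G r' \<longrightarrow> (\<Sum>t<T. r t) \<le> (\<Sum>t<T. r' t)) \<longleftrightarrow>
        (\<forall>r'. ?F r' \<longrightarrow> (\<Sum>t<T. r t) \<le> (\<Sum>t<T. r' t))" for r
    using GF FG Gfeas by (meson less_imp_le order_trans)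
  moreover have "?G r" if "?F r" "\<forall>r'. ?F r' \<longrightarrow> (\<Sum>t<T. r t) \<le> (\<Sum>t<T. r' t)" for r
    using FG[OF that(1)] that(2) feas by (meson not_less)
  ultimately show
    "optimal_radii T (milp_fast_feasible n T p e rfeas) = optimal_radii T (milp_feasible n T p e)"
    using GF unfolding set_eq_iff mem_optimal_radii_iff by meson
qed

lemma optimal_radii_milp_eq_pth_smallest:
  assumes p: "1 \<le> p" and many: "p \<le> card (S1 n T p e)"
    and nonneg: "\<And>t i. t < T \<Longrightarrow> i \<in> {1..n} \<Longrightarrow> e t i \<ge> 0"
  shows "optimal_radii T (milp_feasible n T p e) = {\<lambda>t\<in>{..<T}. pth_smallest n p e t}"
proof -
  let ?F = "\<lambda>r. \<exists>b. milp_feasible n T p e (r, b)"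
  let ?m = "\<lambda>t\<in>{..<T}. pth_smallest n p e t"
  have F_iff: "?F r \<longleftrightarrow> r \<in> {..<T} \<rightarrow>\<^sub>E UNIV \<and> p \<le> card (covered {1..n} T e r)" for r
    by (intro ex_milp_feasible_iff p nonneg)
  \<comment> \<open>By definition \<open>S1\<close> is what the \<open>p\<close>-th smallest values
    cover, so \<open>many\<close> is precisely the feasibility of \<open>?m\<close>.\<close>
  have "covered {1..n} T e ?m = S1 n T p e"
    by (auto simp: covered_def S1_def)
  then have F_m: "?F ?m"
    using many unfolding F_iff by simp
  have le: "?m t \<le> r t" if "?F r" "t < T" for r t
    using that pth_smallest_le_radius[OF p, of n T e r t] unfolding F_iff by simp
  have "?m \<in> optimal_radii T (milp_feasible n T p e)"
    unfolding mem_optimal_radii_iff using F_m le by (blast intro: sum_mono)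
  moreover have "r = ?m" if opt: "r \<in> optimal_radii T (milp_feasible n T p e)" for r
  proof (rule ccontr)
    assume "r \<noteq> ?m"
    have F_r: "?F r" and sum_le: "(\<Sum>t<T. r t) \<le> (\<Sum>t<T. ?m t)"
      using opt F_m unfolding mem_optimal_radii_iff by blast+
    \<comment> \<open>Extensionality forces distinct radii to differ at some \<open>t < T\<close>;
      there \<open>r\<close> is strictly above \<open>?m\<close>, and elsewhere it is not below, so
      its sum is larger.\<close>
    have "r \<in> extensional {..<T}" "?m \<in> extensional {..<T}"
      using F_r unfolding F_iff by (auto simp: PiE_def)
    with \<open>r \<noteq> ?m\<close> obtain t where t: "t < T" "?m t \<noteq> r t"
      by (metis extensionalityI lessThan_iff)
    have "(\<Sum>t<T. ?m t) < (\<Sum>t<T. r t)"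
      using le[OF F_r] t by (intro sum_strict_mono_ex1) (auto simp: order.strict_iff_order)
    with sum_le show False
      by linarith
  qed
  ultimately show ?thesis
    by blast
qed

theorem theorem3:
  fixes n T p :: nat and e :: "nat \<Rightarrow> nat \<Rightarrow> real"
  assumes "n \<ge> 1" and "T \<ge> 1" and "p \<in> {1..n}"
    and "\<And>t i. t < T \<Longrightarrow> i \<in> {1..n} \<Longrightarrow> e t i \<ge> 0"
  shows "(card (S1 n T p e) < p \<longrightarrow>
            (\<forall>rfeas bfeas. milp_feasible n T p e (rfeas, bfeas) \<longrightarrow>
               (\<exists>x. milp_fast_feasible n T p e rfeas x) \<and>
               optimal_radii T (milp_fast_feasible n T p e rfeas)
                 = optimal_radii T (milp_feasible n T p e))) \<and>
         (card (S1 n T p e) \<ge> p \<longrightarrow>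
            optimal_radii T (milp_feasible n T p e)
              = {\<lambda>t\<in>{..<T}. pth_smallest n p e t})"
proof (intro conjI impI allI)
  have p: "1 \<le> p"
    using assms(3) by simp
  show "optimal_radii T (milp_feasible n T p e) = {\<lambda>t\<in>{..<T}. pth_smallest n p e t}"
    if "card (S1 n T p e) \<ge> p"
    using optimal_radii_milp_eq_pth_smallest[OF p that assms(4)] .
  fix rfeas bfeas
  assume few: "card (S1 n T p e) < p" and "milp_feasible n T p e (rfeas, bfeas)"
  then have feas: "\<exists>b. milp_feasible n T p e (rfeas, b)"
    by blast
  note fast = optimal_radii_milp_fast_eq[OF assms(2) few assms(4) feas]
  show "\<exists>x. milp_fast_feasible n T p e rfeas x"
    by (rule fast(1))
  show "optimal_radii T (milp_fast_feasible n T p e rfeas) = optimal_radii T (milp_feasible n T p e)"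
    by (rule fast(2))
qed

end
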